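(* Let $X$ be a metric space, let $\mu$ be a measure over $X$, let $B\subset X$ be nonempty, let $\mathcal S\subset\mathcal P(X)$ be a nonempty class and let $\zeta:\mathcal S\to[0,+\infty]$ be a gauge. Fix $\tau>1$ and assume: (1) $\mathcal S_{\mu,\zeta}$ is made of closed and $\mu$-measurable sets. (2) $\mathcal S_{\mu,\zeta}$ covers $B$ finely. (3) There exist $c\ge1$ and $\eta>0$ such that for every $S\in\mathcal S_{\mu,\zeta}$ there exists $\tilde S\in\mathcal S$ with $\hat S\subset\tilde S$, $\operatorname{diam}(\tilde S)\le c\,\operatorname{diam}(S)$ and $\zeta(\tilde S)\le\eta\,\zeta(S)$. (4) $t>0$ is such that $F^\zeta(\mu,x)>t$ for all $x\in B$. Then for any open set $V$ containing $B$ we have $t\,\psi_\zeta(B)\le\mu(V)$.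
   Context: A "measure over $X$" is an outer measure defined on all subsets of $X$; measurability is in the sense of Carathéodory. A gauge is a function $\zeta:\mathcal S\to[0,+\infty]$ on a nonempty class $\mathcal S\subset\mathcal P(X)$. Convention: $\operatorname{diam}(\emptyset)=0$. Carathéodory measure: for $\delta>0$ and $R\subset X$, $\phi_{\zeta,\delta}(R)=\inf\sum_j\zeta(E_j)$, the infimum being over all countable (possibly finite) families $\{E_j\}\subset\mathcal S$ covering $R$ with $\operatorname{diam}(E_j)\le\delta$ for all $j$ ($\inf\emptyset=+\infty$); $\psi_\zeta(R)=\sup_{\delta>0}\phi_{\zeta,\delta}(R)$. A family $\mathcal G\subset\mathcal P(X)$ covers $B$ finely if for every $b\in B$ and $\epsilon>0$ there is $S\in\mathcal G$ with $b\in S$ and $\operatorname{diam}(S)<\epsilon$. $\mathcal S_{\mu,\zeta}=\mathcal S\setminus\{S\in\mathcal S:\ \zeta(S)=\mu(S)=0\ \text{or}\ \mu(S)=\zeta(S)=+\infty\}$. The quotient function $Q_{\mu,\zeta}:\mathcal S_{\mu,\zeta}\to[0,+\infty]$ is $Q_{\mu,\zeta}(S)=+\infty$ if $\zeta(S)=0$, $Q_{\mu,\zeta}(S)=\mu(S)/\zeta(S)$ if $0<\zeta(S)<+\infty$, and $Q_{\mu,\zeta}(S)=0$ if $\zeta(S)=+\infty$. If for every $\epsilon>0$ some $S\in\mathcal S_{\mu,\zeta}$ satisfies $x\in S$ and $\operatorname{diam}(S)<\epsilon$, the Federer density of $\mu$ at $x$ is $$F^\zeta(\mu,x)=\inf_{\epsilon>0}\sup\{Q_{\mu,\zeta}(S):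 S\in\mathcal S_{\mu,\zeta},\ x\in S,\ \operatorname{diam}(S)<\epsilon\}.$$ For the fixed $\tau>1$, the enlargement of $S$ is $\hat S=\bigcup\{T\in\mathcal S_{\mu,\zeta}: T\cap S\neq\emptyset,\ \operatorname{diam}(T)\le\tau\operatorname{diam}(S)\}$. *)

theory Defs
  imports "HOL-Analysis.Analysis"
begin

text \<open>
  The metric space is the type \<open>'a\<close>. A measure over it is an outer measure on all subsets,
  i.e. the library's \<^const>\<open>outer_measure_space\<close> on the full power set, and the
  Caratheodory measurable sets are the library's \<^const>\<open>lambda_system\<close>.
  (\<^const>\<open>countably_subadditive\<close> only mentions disjoint sequences; on the full power set,
  together with monotonicity, this gives subadditivity for arbitrary sequences.)
\<close>

definition measure_over :: "('a set \<Rightarrow> ennreal) \<Rightarrow> bool" where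
  "measure_over \<mu> \<longleftrightarrow> outer_measure_space (Pow UNIV) \<mu>"

definition caratheodory_measurable :: "('a set \<Rightarrow> ennreal) \<Rightarrow> 'a set \<Rightarrow> bool" where
  "caratheodory_measurable \<mu> A \<longleftrightarrow> A \<in> lambda_system UNIV (Pow UNIV) \<mu>"

text \<open>
  The library's \<^const>\<open>diameter\<close> is real-valued and meaningless for unbounded sets, hence
  an extended diameter. The supremum over the empty set in \<^typ>\<open>ennreal\<close> is 0.
\<close>

definition ediam :: "'a::metric_space set \<Rightarrow> ennreal" where
  "ediam S = (SUP x\<in>S. SUP y\<in>S. ennreal (dist x y))"

text \<open>
  A gauge on a class \<open>\<S>\<close> is a function \<open>\<zeta> :: 'a set \<Rightarrow> ennreal\<close> of which only the values on
  \<open>\<S>\<close> are used. Countable, possibly finite, families are indexed by a subset \<open>J\<close> of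
  \<^typ>\<open>nat\<close>; the infimum over the empty set is \<open>\<infinity>\<close>.
\<close>

definition cara_pre ::
  "'a::metric_space set set \<Rightarrow> ('a set \<Rightarrow> ennreal) \<Rightarrow> real \<Rightarrow> 'a set \<Rightarrow> ennreal" where
  "cara_pre \<S> \<zeta> \<delta> R =
     Inf {(\<Sum>\<^sub>\<infinity>j\<in>J. \<zeta> (E j)) | (J :: nat set) (E :: nat \<Rightarrow> 'a set).
            (\<forall>j\<in>J. E j \<in> \<S> \<and> ediam (E j) \<le> ennreal \<delta>) \<and> R \<subseteq> (\<Union>j\<in>J. E j)}"

definition cara_measure ::
  "'a::metric_space set set \<Rightarrow> ('a set \<Rightarrow> ennreal) \<Rightarrow> 'a set \<Rightarrow> ennreal" where
  "cara_measure \<S> \<zeta> R = (SUP \<delta>\<in>{0<..}. cara_pre \<S> \<zeta> \<delta> R)"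

definition covers_finely :: "'a::metric_space set set \<Rightarrow> 'a set \<Rightarrow> bool" where
  "covers_finely \<G> B \<longleftrightarrow>
     (\<forall>b\<in>B. \<forall>\<epsilon>::real. \<epsilon> > 0 \<longrightarrow> (\<exists>S\<in>\<G>. b \<in> S \<and> ediam S < ennreal \<epsilon>))"

definition restricted_class ::
  "'a set set \<Rightarrow> ('a set \<Rightarrow> ennreal) \<Rightarrow> ('a set \<Rightarrow> ennreal) \<Rightarrow> 'a set set" where
  "restricted_class \<S> \<mu> \<zeta> =
     \<S> - {S \<in> \<S>. (\<zeta> S = 0 \<and> \<mu> S = 0) \<or> (\<mu> S = \<infinity> \<and> \<zeta> S = \<infinity>)}"

definition quotient_fun ::
  "('a set \<Rightarrow> ennreal) \<Rightarrow> ('a set \<Rightarrow> ennreal) \<Rightarrow> 'a set \<Rightarrow> ennreal" where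
  "quotient_fun \<mu> \<zeta> S = (if \<zeta> S = 0 then \<infinity> else if \<zeta> S = \<infinity> then 0 else \<mu> S / \<zeta> S)"

text \<open>
  The Federer density is of interest only at points that are finely covered by
  \<open>restricted_class \<S> \<mu> \<zeta>\<close>; elsewhere this total function has the value 0.
\<close>

definition federer_density ::
  "'a::metric_space set set \<Rightarrow> ('a set \<Rightarrow> ennreal) \<Rightarrow> ('a set \<Rightarrow> ennreal) \<Rightarrow> 'a \<Rightarrow> ennreal" where
  "federer_density \<S> \<mu> \<zeta> x =
     (INF \<epsilon>\<in>{0::real<..}.
        SUP S\<in>{S \<in> restricted_class \<S> \<mu> \<zeta>. x \<in> S \<and> ediam S < ennreal \<epsilon>}. quotient_fun \<mu> \<zeta> S)"

definition enlargement ::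
  "'a::metric_space set set \<Rightarrow> ('a set \<Rightarrow> ennreal) \<Rightarrow> ('a set \<Rightarrow> ennreal) \<Rightarrow> real \<Rightarrow> 'a set \<Rightarrow> 'a set"
  where
  "enlargement \<S> \<mu> \<zeta> \<tau> S =
     \<Union>{T \<in> restricted_class \<S> \<mu> \<zeta>. T \<inter> S \<noteq> {} \<and> ediam T \<le> ennreal \<tau> * ediam S}"

end

theory Submission
  imports Defs
begin

text \<open>
  The sets \<open>S \<subseteq> V\<close> of small diameter with \<open>t \<zeta>(S) < \<mu>(S)\<close> still cover \<open>B\<close> finely. A maximal
  disjoint subfamily \<open>H\<close>, chosen greedily with respect to the diameter, is countable because
  \<open>\<mu>\<close> is positive on its members and \<open>\<mu>(V) < \<infinity>\<close>. Since the sets are closed, for each finite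
  \<open>F \<subseteq> H\<close> the set \<open>B\<close> is covered by \<open>F\<close> together with the enlargements of the members of \<open>H - F\<close>.
  The first part costs at most \<open>\<mu>(V) / t\<close>, the second at most \<open>\<eta> / t\<close> times a tail of the
  convergent sum of \<open>\<mu>\<close> over \<open>H\<close>.
\<close>

section \<open>Infinite sums of \<open>ennreal\<close> families\<close>

lemma infsum_cmult_right_ennreal:
  fixes f :: "'a \<Rightarrow> ennreal"
  shows "(\<Sum>\<^sub>\<infinity>x\<in>A. c * f x) = c * infsum f A"
  by (simp add: nonneg_infsum_complete SUP_mult_left_ennreal sum_distrib_left)

lemma infsum_le_ennreal:
  fixes f :: "'a \<Rightarrow> ennreal"
  assumes "\<And>F. finite F \<Longrightarrow> F \<subseteq> A \<Longrightarrow> sum f F \<le> c"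
  shows "infsum f A \<le> c"
  using assms by (auto simp: nonneg_infsum_complete intro!: SUP_least)

lemma infsum_split_finite_ennreal:
  fixes f :: "'a \<Rightarrow> ennreal"
  assumes "finite F" "F \<subseteq> A"
  shows "infsum f A = sum f F + infsum f (A - F)"
proof -
  have "infsum f (F \<union> (A - F)) = infsum f F + infsum f (A - F)"
    by (intro infsum_Un_disjoint nonneg_summable_on_complete) auto
  then show ?thesis using assms by (simp add: Un_absorb1)
qed

text \<open>Each value is at most the finite total, so \<open>enn2real\<close> loses nothing and the
  countable support of a summable real family is all of \<open>A\<close>.\<close>

lemma countable_of_infsum_finite:
  fixes f :: "'a \<Rightarrow> ennreal"
  assumes fin: "infsum f A < top" and pos: "\<And>x. x \<in> A \<Longrightarrow> 0 < f x"
  shows "countable A"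
proof -
  have ub: "sum f F \<le> infsum f A" if "finite F" "F \<subseteq> A" for F
    using that by (auto simp: nonneg_infsum_complete intro!: SUP_upper)
  have lt_top: "f x < top" if "x \<in> A" for x
    using ub[of "{x}"] that fin by (auto intro: le_less_trans)
  have "(\<lambda>x. enn2real (f x)) summable_on A"
  proof (rule nonneg_bdd_above_summable_on)
    show "bdd_above (sum (\<lambda>x. enn2real (f x)) ` {F. F \<subseteq> A \<and> finite F})"
    proof (rule bdd_aboveI2)
      fix F assume "F \<in> {F. F \<subseteq> A \<and> finite F}"
      then have F: "F \<subseteq> A" "finite F" by auto
      have "(\<Sum>x\<in>F. enn2real (f x)) = enn2real (sum f F)"
        using F lt_top by (subst enn2real_sum) auto
      also have "\<dots> \<le> enn2real (infsum f A)"
        using ub F fin by (intro enn2real_mono) auto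
      finally show "(\<Sum>x\<in>F. enn2real (f x)) \<le> enn2real (infsum f A)" .
    qed
  qed auto
  then have "countable {x \<in> A. enn2real (f x) \<noteq> 0}"
    by (rule summable_countable_real)
  also have "{x \<in> A. enn2real (f x) \<noteq> 0} = A"
    using pos lt_top by (force simp: enn2real_eq_0_iff)
  finally show ?thesis .
qed

lemma infsum_tail_less:
  fixes f :: "'a \<Rightarrow> ennreal"
  assumes fin: "infsum f A < top" and "0 < e"
  obtains F where "finite F" "F \<subseteq> A" "infsum f (A - F) < e"
proof -
  have "\<exists>F. finite F \<and> F \<subseteq> A \<and> infsum f A < sum f F + e"
  \<comment> \<open>Subtracting \<open>e\<close> gives a strictly smaller number only if the sum is
    positive and finite; the case of a sum below \<open>e\<close>, which includes sum 0, is settled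
    by the empty set.\<close>
  proof (cases "infsum f A < e")
    case True
    then show ?thesis by (intro exI[of _ "{}"]) auto
  next
    case False
    then have e: "e \<le> infsum f A" "e < top"
      using fin by auto
    have "infsum f A - e < infsum f A"
      using fin e \<open>0 < e\<close> by (simp add: minus_less_iff_ennreal)
    then obtain F where F: "finite F" "F \<subseteq> A" "infsum f A - e < sum f F"
      unfolding nonneg_infsum_complete[of A f, OF zero_le] less_SUP_iff by auto
    then show ?thesis
      using e by (auto simp: minus_less_iff_ennreal)
  qed
  then obtain F where F: "finite F" "F \<subseteq> A" "infsum f A < sum f F + e" by auto
  have "infsum f A = sum f F + infsum f (A - F)"
    using F by (intro infsum_split_finite_ennreal)
  with F have "infsum f (A - F) < e" by simp
  with F that show ?thesis by blast
qed

section \<open>Disjoint families: sums of measures and greedy selection\<close>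

text \<open>Caratheodory's condition for one member \<open>S\<close> splits \<open>V\<close> into
  \<open>S\<close> and \<open>V - S\<close>, and disjointness puts the other members inside
  \<open>V - S\<close>. Hence the induction lets \<open>V\<close> vary.\<close>

lemma caratheodory_sum_le:
  assumes \<mu>: "measure_over \<mu>" and "finite F" "disjoint F"
    and "\<And>S. S \<in> F \<Longrightarrow> caratheodory_measurable \<mu> S" "\<Union>F \<subseteq> V"
  shows "sum \<mu> F \<le> \<mu> V"
  using assms(2-)
proof (induction F arbitrary: V rule: finite_induct)
  case (insert S F)
  have "disjoint F" using insert.prems(1) by (auto simp: disjoint_def)
  moreover have "\<Union>F \<subseteq> V - S"
    using insert.prems insert.hyps by (fastforce simp: disjoint_def)
  ultimately have "sum \<mu> F \<le> \<mu> (V - S)"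
    using insert.IH[of "V - S"] insert.prems by auto
  then have "sum \<mu> (insert S F) \<le> \<mu> S + \<mu> (V - S)"
    using insert.hyps by (simp add: add_left_mono)
  also have "\<dots> = \<mu> (S \<inter> V) + \<mu> ((UNIV - S) \<inter> V)"
    using insert.prems by (intro arg_cong2[of _ _ _ _ "(+)"] arg_cong[of _ _ \<mu>]) auto
  also have "\<dots> = \<mu> V"
    using insert.prems(2)[of S]
    by (auto simp: caratheodory_measurable_def lambda_system_def Int_commute)
  finally show ?case .
qed auto

text \<open>A Vitali-type selection by Zorn's lemma: as long as some sets miss the chosen ones, a
  set whose size is within the factor \<open>\<tau>\<close> of their supremum can be added.\<close>

lemma greedy_disjoint_subfamily:
  fixes d :: "'a set \<Rightarrow> ennreal" and \<tau> :: real
  assumes "\<tau> > 1" and bound: "\<And>S. S \<in> \<G> \<Longrightarrow> d S \<le> D" "D < top"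
    and ne: "\<And>S. S \<in> \<G> \<Longrightarrow> S \<noteq> {}"
  shows "\<exists>H\<subseteq>\<G>. disjoint H \<and>
    (\<forall>S\<in>\<G>. \<exists>T\<in>H. T \<inter> S \<noteq> {} \<and> d S \<le> ennreal \<tau> * d T)"
proof -
  define dom where "dom H S \<longleftrightarrow> (\<exists>T\<in>H. T \<inter> S \<noteq> {} \<and> d S \<le> ennreal \<tau> * d T)" for H S
  \<comment> \<open>Domination is required only of sets that meet the family. In this form it passes
    to unions of chains, the empty chain included, and it becomes the full claim once no set of \<G>
    misses \<Union>H.\<close>
  define \<Omega> where "\<Omega> = {H. H \<subseteq> \<G> \<and> disjoint H \<and> (\<forall>S\<in>\<G>. S \<inter> \<Union>H \<noteq> {} \<longrightarrow> dom H S)}"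
  have "\<exists>M\<in>\<Omega>. \<forall>H\<in>\<Omega>. M \<subseteq> H \<longrightarrow> H = M"
  proof (rule subset_Zorn')
    fix C assume "subset.chain \<Omega> C"
    then have C: "C \<subseteq> \<Omega>" "\<And>X Y. X \<in> C \<Longrightarrow> Y \<in> C \<Longrightarrow> X \<subseteq> Y \<or> Y \<subseteq> X"
      by (auto simp: subset_chain_def)
    have "disjoint (\<Union>C)"
    proof (rule disjointI)
      fix S T assume *: "S \<in> \<Union>C" "T \<in> \<Union>C" "S \<noteq> T"
      then obtain X where "X \<in> C" "S \<in> X" "T \<in> X" using C(2) by blast
      then show "S \<inter> T = {}" using C(1) * by (auto simp: \<Omega>_def disjoint_def)
    qed
    moreover have "dom (\<Union>C) S" if "S \<in> \<G>" "S \<inter> \<Union>(\<Union>C) \<noteq> {}" for S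
    proof -
      obtain X where "X \<in> C" "S \<inter> \<Union>X \<noteq> {}" using \<open>S \<inter> \<Union>(\<Union>C) \<noteq> {}\<close> by blast
      then have "dom X S" using C(1) that by (auto simp: \<Omega>_def)
      then show ?thesis using \<open>X \<in> C\<close> by (auto simp: dom_def)
    qed
    ultimately show "\<Union>C \<in> \<Omega>" using C(1) by (auto simp: \<Omega>_def)
  qed
  then obtain H where H: "H \<in> \<Omega>" and max: "\<And>H'. H' \<in> \<Omega> \<Longrightarrow> H \<subseteq> H' \<Longrightarrow> H' = H" by blast
  define K where "K = {S \<in> \<G>. S \<inter> \<Union>H = {}}"
  have "K = {}"
  proof (rule ccontr)
    assume "K \<noteq> {}"
    have "\<exists>T\<in>K. Sup (d ` K) \<le> ennreal \<tau> * d T"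
    proof (cases "Sup (d ` K) = 0")
      case True
      then show ?thesis using \<open>K \<noteq> {}\<close> by auto
    next
      case False
      define s where "s = Sup (d ` K)"
      have "s \<le> D" unfolding s_def by (rule SUP_least) (auto simp: K_def bound)
      then have "s < top" using bound(2) by (rule le_less_trans)
      obtain r where r: "s = ennreal r" "r > 0"
        using \<open>s < top\<close> False unfolding s_def[symmetric] by (cases s) (auto simp: less_le)
      \<comment> \<open>Since \<open>\<tau> > 1\<close> and \<open>s\<close> is positive and finite,
        there is room strictly below the supremum. For supremum 0 any member of \<open>K\<close> was
        good enough.\<close>
      have "ennreal (r / \<tau>) < s"
        using r \<open>\<tau> > 1\<close> by (auto simp: ennreal_less_iff field_simps)
      then obtain T where T: "T \<in> K" "ennreal (r / \<tau>) < d T"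
        unfolding s_def less_SUP_iff by auto
      have "s = ennreal \<tau> * ennreal (r / \<tau>)"
        using r \<open>\<tau> > 1\<close> by (simp flip: ennreal_mult)
      also have "\<dots> \<le> ennreal \<tau> * d T" using T by (intro mult_left_mono) auto
      finally show ?thesis using T s_def by auto
    qed
    then obtain T where T: "T \<in> K" "Sup (d ` K) \<le> ennreal \<tau> * d T" by blast
    have dT: "d S \<le> ennreal \<tau> * d T" if "S \<in> K" for S
      using SUP_upper[OF that, of d] T(2) by (rule order_trans)
    have "disjoint (insert T H)"
      using H T by (auto simp: \<Omega>_def K_def disjoint_def)
    moreover have "dom (insert T H) S" if "S \<in> \<G>" "S \<inter> \<Union>(insert T H) \<noteq> {}" for S
    proof (cases "S \<in> K")
      case True
      then show ?thesis using dT that by (auto simp: dom_def K_def)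
    next
      case False
      then have "dom H S" using H that by (auto simp: \<Omega>_def K_def)
      then show ?thesis by (auto simp: dom_def)
    qed
    ultimately have "insert T H \<in> \<Omega>" using H T by (auto simp: \<Omega>_def K_def)
    then have "T \<in> H" using max by blast
    then show False using T ne by (auto simp: K_def)
  qed
  then have "\<And>S. S \<in> \<G> \<Longrightarrow> dom H S" using H by (auto simp: \<Omega>_def K_def)
  with H show ?thesis by (intro exI[of _ H]) (auto simp: \<Omega>_def dom_def)
qed

section \<open>Covers, density and diameter\<close>

text \<open>Transports a cover along \<open>to_nat_on\<close>, so that a countable family of sets
  can serve as its own index set.\<close>

lemma cara_pre_le_infsum:
  assumes "countable I" "\<And>i. i \<in> I \<Longrightarrow> E i \<in> \<S> \<and> ediam (E i) \<le> ennreal \<delta>"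
    and "R \<subseteq> (\<Union>i\<in>I. E i)"
  shows "cara_pre \<S> \<zeta> \<delta> R \<le> (\<Sum>\<^sub>\<infinity>i\<in>I. \<zeta> (E i))"
proof -
  let ?g = "from_nat_into I" and ?J = "to_nat_on I ` I"
  have "(\<Sum>\<^sub>\<infinity>j\<in>?J. \<zeta> (E (?g j))) = (\<Sum>\<^sub>\<infinity>i\<in>I. \<zeta> (E (?g (to_nat_on I i))))"
    using assms(1) by (subst infsum_reindex) (auto simp: o_def inj_on_to_nat_on)
  also have "\<dots> = (\<Sum>\<^sub>\<infinity>i\<in>I. \<zeta> (E i))"
    using assms(1) by (intro infsum_cong) simp
  finally have eq: "(\<Sum>\<^sub>\<infinity>i\<in>I. \<zeta> (E i)) = (\<Sum>\<^sub>\<infinity>j\<in>?J. \<zeta> (E (?g j)))" by simp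
  have "(\<forall>j\<in>?J. E (?g j) \<in> \<S> \<and> ediam (E (?g j)) \<le> ennreal \<delta>) \<and> R \<subseteq> (\<Union>j\<in>?J. E (?g j))"
    using assms by auto
  then show ?thesis
    unfolding cara_pre_def eq
    by (intro Inf_lower CollectI exI[of _ ?J] exI[of _ "\<lambda>j. E (?g j)"]) auto
qed

text \<open>If \<open>\<zeta> S = 0\<close>, membership in the restricted class forces
  \<open>\<mu> S > 0\<close>. The value 0 of the quotient excludes an infinite gauge, and otherwise
  the division can be undone.\<close>

lemma less_quotient_fun_imp:
  assumes "S \<in> restricted_class \<S> \<mu> \<zeta>" "ennreal t < quotient_fun \<mu> \<zeta> S"
  shows "ennreal t * \<zeta> S < \<mu> S"
proof (cases "\<zeta> S = 0")
  case True
  then show ?thesis using assms(1) by (auto simp: restricted_class_def zero_less_iff_neq_zero)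
next
  case False
  then have "\<zeta> S \<noteq> top" "ennreal t < \<mu> S / \<zeta> S"
    using assms(2) by (auto simp: quotient_fun_def split: if_splits)
  show ?thesis
  proof (rule ccontr)
    assume "\<not> ennreal t * \<zeta> S < \<mu> S"
    then have "\<mu> S / \<zeta> S \<le> ennreal t * \<zeta> S / \<zeta> S"
      by (intro divide_right_mono_ennreal) simp
    also have "\<dots> = ennreal t"
      using False \<open>\<zeta> S \<noteq> top\<close> by (intro mult_divide_eq_ennreal) auto
    finally show False using \<open>ennreal t < \<mu> S / \<zeta> S\<close> by simp
  qed
qed

text \<open>The density is an infimum over scales, so the supremum at each single scale exceeds
  \<open>t\<close>.\<close>

lemma federer_density_greater:
  assumes "federer_density \<S> \<mu> \<zeta> x > ennreal t" and "\<epsilon> > 0"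
  obtains S where "S \<in> restricted_class \<S> \<mu> \<zeta>" "x \<in> S" "ediam S < ennreal \<epsilon>"
    "ennreal t * \<zeta> S < \<mu> S"
proof -
  have "ennreal t < (SUP S\<in>{S \<in> restricted_class \<S> \<mu> \<zeta>. x \<in> S \<and> ediam S < ennreal \<epsilon>}. quotient_fun \<mu> \<zeta> S)"
    using assms unfolding federer_density_def by (auto intro: less_le_trans INF_lower)
  then show ?thesis
    using that less_quotient_fun_imp unfolding less_SUP_iff by blast
qed

lemma ediam_less_imp_subset:
  assumes "x \<in> S" "ediam S < ennreal r" "ball x r \<subseteq> U"
  shows "S \<subseteq> U"
proof
  fix y assume "y \<in> S"
  have "ennreal (dist x y) \<le> ediam S"
    unfolding ediam_def using assms(1) \<open>y \<in> S\<close> by (blast intro: SUP_upper2 order_refl)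
  then have "ennreal (dist x y) < ennreal r" using assms(2) by (rule le_less_trans)
  then show "y \<in> U" using assms(3) by (auto simp: ennreal_less_iff)
qed

section \<open>The estimate at a fixed scale and its limit\<close>

lemma cara_pre_le_measure_open:
  fixes \<mu> :: "'a::metric_space set \<Rightarrow> ennreal" and \<tau> t c \<eta> \<delta> :: real
  assumes \<mu>: "measure_over \<mu>" and "\<tau> > 1" and "c \<ge> 1" "\<eta> > 0"
    and meas: "\<And>S. S \<in> restricted_class \<S> \<mu> \<zeta> \<Longrightarrow> closed S \<and> caratheodory_measurable \<mu> S"
    and encl: "\<And>S. S \<in> restricted_class \<S> \<mu> \<zeta> \<Longrightarrow> \<exists>S'\<in>\<S>.
              enlargement \<S> \<mu> \<zeta> \<tau> S \<subseteq> S' \<and>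
              ediam S' \<le> ennreal c * ediam S \<and>
              \<zeta> S' \<le> ennreal \<eta> * \<zeta> S"
    and dens: "\<And>x. x \<in> B \<Longrightarrow> federer_density \<S> \<mu> \<zeta> x > ennreal t"
    and "open V" "B \<subseteq> V" "\<delta> > 0"
  shows "ennreal t * cara_pre \<S> \<zeta> \<delta> B \<le> \<mu> V"
proof (rule ennreal_le_epsilon)
  \<comment> \<open>The rule leaves only the case of finite \<open>\<mu> V\<close>, on which
    countability and small tails depend.\<close>
  fix e :: real assume fin: "\<mu> V < top" and "e > 0"
  let ?R = "restricted_class \<S> \<mu> \<zeta>"
  \<comment> \<open>The bound \<open>\<delta> / c\<close> keeps the enclosing sets within diameter
    \<open>\<delta>\<close>, and the members themselves too as \<open>c \<ge> 1\<close>. The strict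
    inequality makes \<open>\<mu>\<close> positive on \<G>.\<close>
  define \<G> where "\<G> = {S \<in> ?R. S \<subseteq> V \<and> ediam S \<le> ennreal (\<delta> / c) \<and> ennreal t * \<zeta> S < \<mu> S}"
  have \<mu>_empty: "\<mu> {} = 0"
    using \<mu> by (simp add: measure_over_def outer_measure_space_def positive_def)
  have pos: "0 < \<mu> S" if "S \<in> \<G>" for S
    using that by (auto simp: \<G>_def intro: le_less_trans[OF zero_le])
  have ne: "S \<noteq> {}" if "S \<in> \<G>" for S
    using pos[OF that] \<mu>_empty by auto
  \<comment> \<open>The open set \<open>U\<close> will be the complement of a finite union of
    selected sets.\<close>
  have fine: "\<exists>S\<in>\<G>. x \<in> S \<and> S \<subseteq> U" if "x \<in> B" "open U" "x \<in> U" for x U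
  proof -
    have "open (U \<inter> V)" "x \<in> U \<inter> V" using that \<open>open V\<close> \<open>B \<subseteq> V\<close> by auto
    then obtain r where r: "r > 0" "ball x r \<subseteq> U \<inter> V" by (meson openE)
    obtain S where S: "S \<in> ?R" "x \<in> S" "ediam S < ennreal (min r (\<delta> / c))"
        "ennreal t * \<zeta> S < \<mu> S"
      using federer_density_greater[OF dens[OF \<open>x \<in> B\<close>], of "min r (\<delta> / c)"] r \<open>\<delta> > 0\<close> \<open>c \<ge> 1\<close>
      by auto
    have "ediam S < ennreal r" "ediam S < ennreal (\<delta> / c)"
      using S(3) by (auto elim!: less_le_trans intro!: ennreal_leI)
    with S r ediam_less_imp_subset[of x S r "U \<inter> V"] show ?thesis
      by (intro bexI[of _ S]) (auto simp: \<G>_def)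
  qed
  have small: "ediam S \<le> ennreal (\<delta> / c)" if "S \<in> \<G>" for S
    using that by (simp add: \<G>_def)
  have "\<exists>H\<subseteq>\<G>. disjoint H \<and>
      (\<forall>S\<in>\<G>. \<exists>T\<in>H. T \<inter> S \<noteq> {} \<and> ediam S \<le> ennreal \<tau> * ediam T)"
    using \<open>\<tau> > 1\<close> small ennreal_less_top ne by (rule greedy_disjoint_subfamily)
  then obtain H where H: "H \<subseteq> \<G>" "disjoint H"
      and greedy: "\<And>S. S \<in> \<G> \<Longrightarrow> \<exists>T\<in>H. T \<inter> S \<noteq> {} \<and> ediam S \<le> ennreal \<tau> * ediam T"
    by blast
  have sum_le: "sum \<mu> F \<le> \<mu> V" if "finite F" "F \<subseteq> H" for F
  proof (rule caratheodory_sum_le[OF \<mu> \<open>finite F\<close>])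
    show "disjoint F" using H(2) that(2) by (auto simp: disjoint_def)
  qed (use H that meas in \<open>auto simp: \<G>_def\<close>)
  have "infsum \<mu> H \<le> \<mu> V"
    using sum_le by (rule infsum_le_ennreal)
  then have H_fin: "infsum \<mu> H < top" using fin by (rule le_less_trans)
  have "countable H"
    using H_fin by (rule countable_of_infsum_finite) (use H pos in auto)
  \<comment> \<open>Replacing the tail members by their enclosing sets costs a factor
    \<open>\<eta>\<close>, which turns \<open>e / \<eta>\<close> into \<open>e\<close>.\<close>
  obtain F where F: "finite F" "F \<subseteq> H" "infsum \<mu> (H - F) < ennreal (e / \<eta>)"
    using infsum_tail_less[OF H_fin, of "ennreal (e / \<eta>)"] \<open>e > 0\<close> \<open>\<eta> > 0\<close> by auto
  have "\<forall>S\<in>?R. \<exists>S'. S' \<in> \<S> \<and> enlargement \<S> \<mu> \<zeta> \<tau> S \<subseteq> S' \<and>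
              ediam S' \<le> ennreal c * ediam S \<and> \<zeta> S' \<le> ennreal \<eta> * \<zeta> S"
    using encl by blast
  from bchoice[OF this] obtain N where N: "\<And>S. S \<in> ?R \<Longrightarrow> N S \<in> \<S> \<and> enlargement \<S> \<mu> \<zeta> \<tau> S \<subseteq> N S \<and>
              ediam (N S) \<le> ennreal c * ediam S \<and> \<zeta> (N S) \<le> ennreal \<eta> * \<zeta> S"
    by blast
  \<comment> \<open>Both parts of the cover become one family indexed by \<open>H\<close>, with only
    the tail enlarged.\<close>
  define E where "E S = (if S \<in> F then S else N S)" for S
  have HR: "S \<in> ?R" "ediam S \<le> ennreal (\<delta> / c)" "ennreal t * \<zeta> S \<le> \<mu> S" if "S \<in> H" for S
    using that H(1) by (auto simp: \<G>_def)
  have "cara_pre \<S> \<zeta> \<delta> B \<le> (\<Sum>\<^sub>\<infinity>S\<in>H. \<zeta> (E S))"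
  proof (rule cara_pre_le_infsum[OF \<open>countable H\<close>])
    fix S assume "S \<in> H"
    have "ediam S \<le> ennreal \<delta>"
      using HR(2)[OF \<open>S \<in> H\<close>] \<open>c \<ge> 1\<close> \<open>\<delta> > 0\<close>
      by (elim order_trans) (auto intro!: ennreal_leI simp: field_simps)
    moreover have "ediam (N S) \<le> ennreal \<delta>"
    proof -
      have "ediam (N S) \<le> ennreal c * ennreal (\<delta> / c)"
        using N[OF HR(1)] HR(2) \<open>S \<in> H\<close> by (meson mult_left_mono order_trans zero_le)
      also have "\<dots> = ennreal \<delta>"
        using \<open>c \<ge> 1\<close> \<open>\<delta> > 0\<close> by (simp flip: ennreal_mult)
      finally show ?thesis .
    qed
    moreover have "S \<in> \<S>" using HR(1)[OF \<open>S \<in> H\<close>] by (auto simp: restricted_class_def)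
    ultimately show "E S \<in> \<S> \<and> ediam (E S) \<le> ennreal \<delta>"
      using N[OF HR(1)[OF \<open>S \<in> H\<close>]] by (auto simp: E_def)
  next
    show "B \<subseteq> (\<Union>S\<in>H. E S)"
    proof
      fix x assume "x \<in> B"
      show "x \<in> (\<Union>S\<in>H. E S)"
      proof (cases "x \<in> \<Union>F")
        case True
        then show ?thesis using F by (auto simp: E_def)
      next
        case False
        have "closed (\<Union>F)" using F HR meas by (intro closed_Union) auto
        \<comment> \<open>As \<open>S\<close> misses \<Union>F, any selected \<open>T\<close>
          meeting \<open>S\<close> lies outside \<open>F\<close>, so that \<open>E T\<close> is
          \<open>N T\<close> and contains the enlargement of \<open>T\<close>.\<close>
        then obtain S where S: "S \<in> \<G>" "x \<in> S" "S \<inter> \<Union>F = {}"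
          using fine[of x "- \<Union>F"] \<open>x \<in> B\<close> False by (auto simp: open_Compl)
        obtain T where T: "T \<in> H" "T \<inter> S \<noteq> {}" "ediam S \<le> ennreal \<tau> * ediam T"
          using greedy[OF S(1)] by blast
        have "T \<notin> F" using S T by auto
        have "S \<subseteq> enlargement \<S> \<mu> \<zeta> \<tau> T"
          using S T by (auto simp: enlargement_def \<G>_def)
        then have "x \<in> E T" using N[OF HR(1)[OF T(1)]] S \<open>T \<notin> F\<close> by (auto simp: E_def)
        then show ?thesis using T by blast
      qed
    qed
  qed
  then have "ennreal t * cara_pre \<S> \<zeta> \<delta> B \<le> ennreal t * (\<Sum>\<^sub>\<infinity>S\<in>H. \<zeta> (E S))"
    by (rule mult_left_mono) simp
  also have "\<dots> = (\<Sum>\<^sub>\<infinity>S\<in>H. ennreal t * \<zeta> (E S))"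
    by (rule infsum_cmult_right_ennreal[symmetric])
  also have "\<dots> = (\<Sum>S\<in>F. ennreal t * \<zeta> (E S)) + (\<Sum>\<^sub>\<infinity>S\<in>H - F. ennreal t * \<zeta> (E S))"
    using F by (intro infsum_split_finite_ennreal)
  \<comment> \<open>The factor \<open>\<eta>\<close> enters only on the tail, so the main term keeps
    the constant 1.\<close>
  also have "\<dots> \<le> sum \<mu> F + (\<Sum>\<^sub>\<infinity>S\<in>H - F. ennreal \<eta> * \<mu> S)"
  proof (intro add_mono sum_mono infsum_mono nonneg_summable_on_complete)
    fix S assume "S \<in> F"
    then show "ennreal t * \<zeta> (E S) \<le> \<mu> S" using HR(3) F by (auto simp: E_def)
  next
    fix S assume S: "S \<in> H - F"
    then have "ennreal t * \<zeta> (E S) \<le> ennreal t * (ennreal \<eta> * \<zeta> S)"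
      using N HR(1) by (intro mult_left_mono) (auto simp: E_def)
    also have "\<dots> = ennreal \<eta> * (ennreal t * \<zeta> S)" by (simp add: mult.left_commute)
    also have "\<dots> \<le> ennreal \<eta> * \<mu> S" using HR(3) S by (intro mult_left_mono) auto
    finally show "ennreal t * \<zeta> (E S) \<le> ennreal \<eta> * \<mu> S" .
  qed auto
  also have "\<dots> = sum \<mu> F + ennreal \<eta> * infsum \<mu> (H - F)"
    by (simp add: infsum_cmult_right_ennreal)
  also have "\<dots> \<le> \<mu> V + ennreal \<eta> * ennreal (e / \<eta>)"
    using sum_le F by (intro add_mono mult_left_mono) auto
  also have "ennreal \<eta> * ennreal (e / \<eta>) = ennreal e"
    using \<open>e > 0\<close> \<open>\<eta> > 0\<close> by (simp flip: ennreal_mult)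
  finally show "ennreal t * cara_pre \<S> \<zeta> \<delta> B \<le> \<mu> V + ennreal e" .
qed

theorem lemma3p2:
  fixes \<mu> :: "'a::metric_space set \<Rightarrow> ennreal"
    and B :: "'a set"
    and \<S> :: "'a set set"
    and \<zeta> :: "'a set \<Rightarrow> ennreal"
    and \<tau> t :: real
  assumes "measure_over \<mu>"
    and "B \<noteq> {}"
    and "\<S> \<noteq> {}"
    and "\<tau> > 1"
    and "\<And>S. S \<in> restricted_class \<S> \<mu> \<zeta> \<Longrightarrow> closed S \<and> caratheodory_measurable \<mu> S"
    and "covers_finely (restricted_class \<S> \<mu> \<zeta>) B"
    and "\<exists>c \<eta> :: real. c \<ge> 1 \<and> \<eta> > 0 \<and>
           (\<forall>S\<in>restricted_class \<S> \<mu> \<zeta>. \<exists>S'\<in>\<S>.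
              enlargement \<S> \<mu> \<zeta> \<tau> S \<subseteq> S' \<and>
              ediam S' \<le> ennreal c * ediam S \<and>
              \<zeta> S' \<le> ennreal \<eta> * \<zeta> S)"
    and "t > 0"
    and "\<And>x. x \<in> B \<Longrightarrow> federer_density \<S> \<mu> \<zeta> x > ennreal t"
  shows "\<And>V. open V \<Longrightarrow> B \<subseteq> V \<Longrightarrow> ennreal t * cara_measure \<S> \<zeta> B \<le> \<mu> V"
proof -
  fix V assume V: "open V" "B \<subseteq> V"
  obtain c \<eta> :: real where "c \<ge> 1" "\<eta> > 0" and encl: "\<forall>S\<in>restricted_class \<S> \<mu> \<zeta>. \<exists>S'\<in>\<S>.
      enlargement \<S> \<mu> \<zeta> \<tau> S \<subseteq> S' \<and> ediam S' \<le> ennreal c * ediam S \<and> \<zeta> S' \<le> ennreal \<eta> * \<zeta> S"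
    using assms(7) by blast
  \<comment> \<open>The right-hand side is independent of \<open>\<delta>\<close>, so the bound
    passes to the supremum over all scales.\<close>
  have "ennreal t * cara_pre \<S> \<zeta> \<delta> B \<le> \<mu> V" if "\<delta> > 0" for \<delta>
    using assms(1,4) \<open>c \<ge> 1\<close> \<open>\<eta> > 0\<close> assms(5) bspec[OF encl] assms(9) V that
    by (rule cara_pre_le_measure_open)
  then show "ennreal t * cara_measure \<S> \<zeta> B \<le> \<mu> V"
    unfolding cara_measure_def SUP_mult_left_ennreal by (intro SUP_least) auto
qed

end
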